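(* Let $n\ge 1$, let $\alpha_1,\dots,\alpha_n\in\mathbb{C}$, let $\lambda>0$ be real, and set $$F_\lambda(z)=\prod_{i=1}^{n}\left(z-\frac{\alpha_i}{\lambda}\right).$$ Suppose that $$\lambda\ \ge\ 6.75\,\sqrt[n]{\frac1n\sum_{i=1}^n|\alpha_i|^n}.$$ Then the Blaschke factorization $F_\lambda(z)=B(z)\cdot G_\lambda(z)$ (with respect to the unit disk) satisfies $$\|G_\lambda\|_{\mathcal D}^2\ \le\ \frac12\,\|F_\lambda\|_{\mathcal D}^2 .$$
   Context: Blaschke factorization with respect to the unit disk: for a nonzero polynomial $P$, let $B(z)=\prod_{i}\frac{z-\beta_i}{1-\overline{\beta_i}z}$, the product being over the roots $\beta_i$ of $P$, counted with multiplicity, with $|\beta_i|<1$; then $P=B\cdot G$, where the polynomial $G=P/B$ is obtained from $P$ by replacing each factor $z-\beta_i$ with $|\beta_i|<1$ by $1-\overline{\beta_i}z$. Dirichlet (semi)norm: for $f(z)=\sum_{k\ge 0}a_kz^k$, $\|f\|_{\mathcal D}^2=\sum_{k\ge 1}k|a_k|^2$. *)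

theory Defs
  imports "HOL-Analysis.Analysis" "HOL-Computational_Algebra.Fundamental_Theorem_Algebra"
begin

definition blaschke_product :: "complex poly \<Rightarrow> complex \<Rightarrow> complex" where
  "blaschke_product P z =
     (\<Prod>\<beta>\<in>#filter_mset (\<lambda>\<beta>. cmod \<beta> < 1) (proots P). (z - \<beta>) / (1 - cnj \<beta> * z))"

text \<open>
  The polynomial \<open>G = P / B\<close>: in the factorization of \<open>P\<close> into linear factors, every factor
  \<open>z - \<beta>\<close> with \<open>cmod \<beta> < 1\<close> is replaced by \<open>1 - cnj \<beta> * z\<close>.
\<close>
definition blaschke_cofactor :: "complex poly \<Rightarrow> complex poly" where
  "blaschke_cofactor P =
     smult (lead_coeff P)
       (\<Prod>\<beta>\<in>#proots P. if cmod \<beta> < 1 then [:1, - cnj \<beta>:] else [:- \<beta>, 1:])"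

text \<open>
  The side condition excludes exactly the poles of the Blaschke product, which all lie outside
  the closed unit disk (at these points Isabelle's division by zero would give a junk value).
\<close>
lemma blaschke_factorization:
  assumes "\<And>\<beta>. poly P \<beta> = 0 \<Longrightarrow> cmod \<beta> < 1 \<Longrightarrow> 1 - cnj \<beta> * z \<noteq> 0"
  shows "poly P z = blaschke_product P z * poly (blaschke_cofactor P) z"
proof (cases "P = 0")
  case True
  then show ?thesis by (simp add: blaschke_cofactor_def)
next
  case False
  have gen: "poly (\<Prod>\<beta>\<in>#M. [:- \<beta>, 1:]) z =
      (\<Prod>\<beta>\<in>#filter_mset (\<lambda>\<beta>. cmod \<beta> < 1) M. (z - \<beta>) / (1 - cnj \<beta> * z)) *
      poly (\<Prod>\<beta>\<in>#M. if cmod \<beta> < 1 then [:1, - cnj \<beta>:] else [:- \<beta>, 1:]) z"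
    if "\<forall>\<beta>\<in>#M. cmod \<beta> < 1 \<longrightarrow> 1 - cnj \<beta> * z \<noteq> 0" for M
    using that
  proof (induction M)
    case empty
    then show ?case by simp
  next
    case (add b M)
    show ?case
    proof (cases "cmod b < 1")
      case True
      then have "1 - cnj b * z \<noteq> 0" using add.prems by simp
      moreover have "poly [:1, - cnj b:] z = 1 - cnj b * z" by (simp add: algebra_simps)
      ultimately show ?thesis using True add by (simp del: poly_pCons) (simp add: field_simps)
    next
      case False
      then show ?thesis using add by (simp add: algebra_simps)
    qed
  qed
  have "poly P z = poly (smult (lead_coeff P) (\<Prod>\<beta>\<in>#proots P. [:- \<beta>, 1:])) z"
    by (simp only: complex_poly_decompose_multiset)
  then show ?thesis
    using gen[of "proots P"] assms False
    by (simp add: blaschke_product_def blaschke_cofactor_def)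
qed

corollary blaschke_factorization_disk:
  assumes "cmod z \<le> 1"
  shows "poly P z = blaschke_product P z * poly (blaschke_cofactor P) z"
proof (rule blaschke_factorization)
  fix \<beta> assume "cmod \<beta> < 1"
  then have "cmod (cnj \<beta> * z) < 1"
    using assms by (metis complex_mod_cnj mult_left_le norm_ge_zero norm_mult order_le_less_trans)
  then show "1 - cnj \<beta> * z \<noteq> 0" by auto
qed

definition dirichlet_norm :: "complex poly \<Rightarrow> real" where
  "dirichlet_norm f = sqrt (\<Sum>k=1..degree f. real k * (cmod (coeff f k))\<^sup>2)"

lemma dirichlet_norm_squared:
  "(dirichlet_norm f)\<^sup>2 = (\<Sum>k=1..degree f. real k * (cmod (coeff f k))\<^sup>2)"
  by (simp add: dirichlet_norm_def sum_nonneg)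

lemma dirichlet_norm_squared_sums:
  "(\<lambda>k. real k * (cmod (coeff f k))\<^sup>2) sums (dirichlet_norm f)\<^sup>2"
  unfolding dirichlet_norm_squared
  by (rule sums_finite) (auto simp: coeff_eq_0 not_le Suc_le_eq)

end

theory Submission
  imports Defs
begin

text \<open>
  Write \<open>F = (z - \<beta>\<^sub>1) \<dots> (z - \<beta>\<^sub>n)\<close>. The hypothesis says that \<open>y\<^sub>i = (27/4) \<bar>\<beta>\<^sub>i\<bar>\<close>
  has mean \<open>n\<close>-th power at most \<open>1\<close>. In particular \<open>y\<^sub>i\<^sup>n \<le> n < (27/4)\<^sup>n\<close>, so all roots lie in the
  disk, every factor is replaced, and \<open>G\<close> is the conjugate reversal of \<open>F\<close>
  (\<open>blaschke_cofactor_roots_in_disk\<close>, \<open>prod_linear_factors_eq_map_cnj_reflect\<close>). With \<open>b\<^sub>k\<close> the modulus of the \<open>k\<close>-th coefficient of \<open>G\<close>,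
  the two squared seminorms are therefore \<open>\<Sum> k b\<^sub>k\<^sup>2\<close> for \<open>G\<close> and \<open>\<Sum> (n - k) b\<^sub>k\<^sup>2\<close> for \<open>F\<close>, and the
  claim becomes \<open>\<Sum> (3k - n) b\<^sub>k\<^sup>2 \<le> 0\<close>. The term \<open>k = 0\<close> contributes \<open>-n \<le> -1\<close>, so it suffices that
  the terms with \<open>3k > n\<close> add up to at most \<open>1\<close>.

  The \<open>b\<^sub>k\<close> are small for large \<open>k\<close>: multiplying out the factors of \<open>G\<close> gives
  \<open>\<Sum> b\<^sub>k s\<^sup>k \<le> \<Prod> (1 + s \<bar>\<beta>\<^sub>i\<bar>)\<close> (\<open>weighted_coeff_sum_linear_factors_le\<close>). Choose \<open>s = 27/8\<close>; the
  right-hand side is \<open>\<Prod> (1 + y\<^sub>i / 2)\<close>, which is at most \<open>(3/2)\<^sup>n\<close> because the mean of the \<open>y\<^sub>i\<close> is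
  at most \<open>1\<close> (\<open>prod_one_plus_half_le\<close>). Hence the weights \<open>Q\<^sub>k = b\<^sub>k (27/8)\<^sup>k (2/3)\<^sup>n\<close> have sum at
  most \<open>1\<close>. Since \<open>(27/8)\<^sup>k (2/3)\<^sup>n = (3/2)\<^bsup>3k - n\<^esup>\<close>, the term with \<open>m = 3k - n > 0\<close> is
  \<open>m (4/9)\<^sup>m Q\<^sub>k\<^sup>2 \<le> Q\<^sub>k\<close>, and these terms add up to at most \<open>1\<close>
  (\<open>sum_weighted_squares_le_half\<close>). The constant \<open>27/4\<close> is what makes the bound
  \<open>b\<^sub>k \<le> (3/2)\<^bsup>n - 3k\<^esup>\<close> drop below \<open>1\<close> exactly where \<open>3k - n\<close> becomes positive.
\<close>

section \<open>The cofactor as the conjugate reversal\<close>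

lemma map_poly_cnj_prod:
  "map_poly cnj (\<Prod>i\<in>A. f i) = (\<Prod>i\<in>A. map_poly cnj (f i))"
  by (simp add: poly_eq_poly_eq_iff[symmetric] fun_eq_iff poly_prod)

lemma reflect_poly_linear_factor:
  "reflect_poly [:- b, 1:] = [:1, - b :: complex:]"
  by (simp add: reflect_poly_pCons' monom_altdef)

lemma prod_linear_factors_eq_map_cnj_reflect:
  fixes \<beta> :: "'a \<Rightarrow> complex"
  shows "(\<Prod>i\<in>A. [:1, - cnj (\<beta> i):]) = map_poly cnj (reflect_poly (\<Prod>i\<in>A. [:- \<beta> i, 1:]))"
  by (simp add: reflect_poly_prod reflect_poly_linear_factor map_poly_cnj_prod map_poly_pCons)

lemma blaschke_cofactor_roots_in_disk:
  fixes \<beta> :: "'a \<Rightarrow> complex"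
  assumes "finite A" and "\<And>i. i \<in> A \<Longrightarrow> cmod (\<beta> i) < 1"
  shows "blaschke_cofactor (\<Prod>i\<in>A. [:- \<beta> i, 1:]) = (\<Prod>i\<in>A. [:1, - cnj (\<beta> i):])"
proof -
  have "proots (\<Prod>i\<in>A. [:- \<beta> i, 1:]) = (\<Sum>i\<in>A. {#\<beta> i#})"
    by (subst proots_prod) auto
  also have "\<dots> = image_mset \<beta> (mset_set A)"
    using assms(1) by (induction A rule: finite_induct) auto
  finally have roots: "proots (\<Prod>i\<in>A. [:- \<beta> i, 1:]) = image_mset \<beta> (mset_set A)" .
  have lead: "lead_coeff (\<Prod>i\<in>A. [:- \<beta> i, 1:]) = 1"
    by (simp only: lead_coeff_prod) simp
  have "blaschke_cofactor (\<Prod>i\<in>A. [:- \<beta> i, 1:]) =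
      (\<Prod>i\<in>A. if cmod (\<beta> i) < 1 then [:1, - cnj (\<beta> i):] else [:- \<beta> i, 1:])"
    unfolding blaschke_cofactor_def roots lead
    by (simp add: prod_unfold_prod_mset multiset.map_comp comp_def)
  also have "\<dots> = (\<Prod>i\<in>A. [:1, - cnj (\<beta> i):])"
    using assms(2) by (intro prod.cong) auto
  finally show ?thesis .
qed

lemma degree_prod_linear_factors:
  fixes \<beta> :: "'a \<Rightarrow> complex"
  shows "degree (\<Prod>i\<in>A. [:- \<beta> i, 1:]) = card A"
  by (simp add: degree_prod_sum_eq)

lemma dirichlet_norm_squared_atMost:
  assumes "degree f \<le> n"
  shows "(dirichlet_norm f)\<^sup>2 = (\<Sum>k\<le>n. real k * (cmod (coeff f k))\<^sup>2)"
  unfolding dirichlet_norm_squared using assms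
  by (intro sum.mono_neutral_left) (auto simp: coeff_eq_0 not_le Suc_le_eq)

section \<open>Decay of the coefficients\<close>

text \<open>
  The weighted coefficient norm \<open>\<Sum> \<bar>c\<^sub>k\<bar> s\<^sup>k\<close> is submultiplicative, and a linear factor
  \<open>1 + c z\<close> has norm \<open>1 + s \<bar>c\<bar>\<close>.
\<close>

lemma weighted_coeff_sum_linear_factors_le:
  fixes c :: "'a \<Rightarrow> complex" and s :: real
  assumes "finite A" and "s \<ge> 0"
  shows "(\<Sum>k\<le>card A. cmod (coeff (\<Prod>i\<in>A. [:1, c i:]) k) * s ^ k)
           \<le> (\<Prod>i\<in>A. 1 + s * cmod (c i))"
  using assms(1)
proof (induction A rule: finite_induct)
  case empty
  then show ?case by simp
next
  case (insert a A)
  define p where "p = (\<Prod>i\<in>A. [:1, c i:])"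
  define N where "N = card A"
  define S where "S = (\<Sum>k\<le>N. cmod (coeff p k) * s ^ k)"
  have "degree p \<le> (\<Sum>i\<in>A. degree [:1, c i:])"
    unfolding p_def by (rule degree_prod_sum_le[unfolded comp_def]) (fact insert.hyps)
  also have "\<dots> \<le> (\<Sum>i\<in>A. 1)"
    by (intro sum_mono) simp
  finally have deg: "degree p \<le> N" by (simp add: N_def)
  have "(\<Sum>k\<le>Suc N. cmod (coeff ([:1, c a:] * p) k) * s ^ k)
      \<le> (\<Sum>k\<le>Suc N. cmod (coeff p k) * s ^ k
            + cmod (c a) * (cmod (coeff (pCons 0 p) k) * s ^ k))"
  proof (intro sum_mono)
    fix k
    have "[:1, c a:] * p = p + smult (c a) (pCons 0 p)" by simp
    then have "cmod (coeff ([:1, c a:] * p) k)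
        \<le> cmod (coeff p k) + cmod (c a) * cmod (coeff (pCons 0 p) k)"
      by (metis coeff_add coeff_smult norm_mult norm_triangle_ineq)
    then have "cmod (coeff ([:1, c a:] * p) k) * s ^ k
        \<le> (cmod (coeff p k) + cmod (c a) * cmod (coeff (pCons 0 p) k)) * s ^ k"
      using assms(2) by (intro mult_right_mono) auto
    then show "cmod (coeff ([:1, c a:] * p) k) * s ^ k
        \<le> cmod (coeff p k) * s ^ k + cmod (c a) * (cmod (coeff (pCons 0 p) k) * s ^ k)"
      by (simp only: distrib_right mult.assoc)
  qed
  also have "\<dots> = (\<Sum>k\<le>Suc N. cmod (coeff p k) * s ^ k)
      + cmod (c a) * (\<Sum>k\<le>Suc N. cmod (coeff (pCons 0 p) k) * s ^ k)"
    by (simp only: sum.distrib sum_distrib_left)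
  also have "(\<Sum>k\<le>Suc N. cmod (coeff p k) * s ^ k) = S"
    using deg by (simp add: S_def coeff_eq_0)
  also have "(\<Sum>k\<le>Suc N. cmod (coeff (pCons 0 p) k) * s ^ k) = s * S"
    by (subst sum.atMost_Suc_shift) (simp add: S_def sum_distrib_left mult_ac)
  also have "S + cmod (c a) * (s * S) = (1 + s * cmod (c a)) * S"
    by (simp add: algebra_simps)
  also have "\<dots> \<le> (1 + s * cmod (c a)) * (\<Prod>i\<in>A. 1 + s * cmod (c i))"
    using insert.IH assms(2) by (intro mult_left_mono) (auto simp: S_def p_def N_def)
  finally show ?case
    using insert.hyps by (simp add: p_def N_def)
qed

text \<open>
  By the tangent inequality \<open>y\<^sup>n \<ge> 1 + n (y - 1)\<close> the arithmetic mean of the \<open>y\<^sub>i\<close> is at most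
  \<open>1\<close>. The product is then largest when all \<open>y\<^sub>i\<close> equal \<open>1\<close>, which the tangent to \<open>exp\<close> at \<open>0\<close>
  shows: \<open>1 + y / 2 = (3/2) (1 + (y - 1) / 3) \<le> (3/2) exp ((y - 1) / 3)\<close>.
\<close>

lemma prod_one_plus_half_le:
  fixes y :: "'a \<Rightarrow> real"
  assumes "finite A" and "n = card A" and "n \<ge> 1"
    and nonneg: "\<And>i. i \<in> A \<Longrightarrow> y i \<ge> 0"
    and pow: "(\<Sum>i\<in>A. y i ^ n) \<le> real n"
  shows "(\<Prod>i\<in>A. 1 + y i / 2) \<le> (3 / 2) ^ n"
proof -
  have "(\<Sum>i\<in>A. 1 + real n * (y i - 1)) \<le> (\<Sum>i\<in>A. y i ^ n)"
    using Bernoulli_inequality[of "y i - 1" n for i] nonneg by (intro sum_mono) force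
  then have "real n + real n * (\<Sum>i\<in>A. y i - 1) \<le> real n"
    using pow assms(2) by (simp only: sum.distrib sum_distrib_left) simp
  then have mean: "(\<Sum>i\<in>A. y i - 1) \<le> 0"
    using assms(3) by (simp add: mult_le_0_iff)
  have "(\<Prod>i\<in>A. 1 + y i / 2) \<le> (\<Prod>i\<in>A. 3 / 2 * exp ((y i - 1) / 3))"
  proof (intro prod_mono conjI)
    fix i assume "i \<in> A"
    show "0 \<le> 1 + y i / 2" using nonneg[OF \<open>i \<in> A\<close>] by simp
    show "1 + y i / 2 \<le> 3 / 2 * exp ((y i - 1) / 3)"
      using exp_ge_add_one_self[of "(y i - 1) / 3"] by (simp add: field_simps)
  qed
  also have "\<dots> = (3 / 2) ^ n * exp ((\<Sum>i\<in>A. y i - 1) / 3)"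
    using assms(1,2) by (simp only: prod.distrib exp_sum[symmetric] sum_divide_distrib) simp
  also have "\<dots> \<le> (3 / 2) ^ n"
    using mean by simp
  finally show ?thesis .
qed

section \<open>Comparison of the two seminorms\<close>

text \<open>
  This is the numerical core: the weights \<open>Q\<^sub>k = b\<^sub>k (27/8)\<^sup>k (2/3)\<^sup>n\<close> have sum at most \<open>1\<close>, and
  \<open>(3k - n) b\<^sub>k\<^sup>2 \<le> Q\<^sub>k\<close> for every \<open>k \<le> n\<close>; the negative term \<open>-n\<close> at \<open>k = 0\<close> absorbs the total.
\<close>

lemma sum_weighted_squares_le_half:
  fixes b :: "nat \<Rightarrow> real"
  assumes "n \<ge> 1" and nonneg: "\<And>k. b k \<ge> 0" and "b 0 = 1"
    and decay: "(\<Sum>k\<le>n. b k * (27 / 8) ^ k) \<le> (3 / 2) ^ n"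
  shows "(\<Sum>k\<le>n. real k * (b k)\<^sup>2) \<le> 1 / 2 * (\<Sum>k\<le>n. real (n - k) * (b k)\<^sup>2)"
proof -
  define Q where "Q k = b k * (27 / 8) ^ k * (2 / 3) ^ n" for k
  have Q0: "Q k \<ge> 0" for k
    using nonneg by (simp add: Q_def)
  have "(\<Sum>k\<le>n. Q k) = (\<Sum>k\<le>n. b k * (27 / 8) ^ k) * (2 / 3) ^ n"
    by (simp add: Q_def sum_distrib_right)
  also have "\<dots> \<le> (3 / 2) ^ n * (2 / 3) ^ n"
    using decay by (intro mult_right_mono) auto
  also have "\<dots> = 1"
    by (simp flip: power_mult_distrib)
  finally have sumQ: "(\<Sum>k\<le>n. Q k) \<le> 1" .
  have Q1: "Q k \<le> 1" if "k \<le> n" for k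
    using member_le_sum[of k "{..n}" Q] sumQ Q0 that by force
  have term_le: "(3 * real k - real n) * (b k)\<^sup>2 \<le> Q k" if "k \<le> n" for k
  proof (cases "3 * k \<le> n")
    case True
    then have "3 * real k - real n \<le> 0" by linarith
    then have "(3 * real k - real n) * (b k)\<^sup>2 \<le> 0"
      by (simp add: mult_nonpos_nonneg)
    with Q0[of k] show ?thesis by linarith
  next
    case False
    define m where "m = 3 * k - n"
    have m: "3 * k = n + m" using False by (simp add: m_def)
    \<comment> \<open>As \<open>27/8 = (3/2)\<^sup>3\<close>, the weight of \<open>b k\<close> in \<open>Q k\<close> is exactly \<open>(3/2)\<^sup>m\<close>.\<close>
    have "(27 / 8 :: real) ^ k = ((3 / 2) ^ 3) ^ k"
      by (simp add: power3_eq_cube)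
    also have "\<dots> = (3 / 2) ^ (n + m)"
      by (simp only: power_mult[symmetric] m)
    finally have "Q k = b k * (3 / 2) ^ m * ((3 / 2) ^ n * (2 / 3) ^ n)"
      by (simp add: Q_def power_add)
    also have "(3 / 2 :: real) ^ n * (2 / 3) ^ n = 1"
      by (simp flip: power_mult_distrib)
    finally have Q_eq: "Q k = b k * (3 / 2) ^ m"
      by simp
    have "b k = b k * ((3 / 2) ^ m * (2 / 3) ^ m)"
      by (simp flip: power_mult_distrib)
    then have "b k = Q k * (2 / 3) ^ m"
      by (simp add: Q_eq)
    then have "(b k)\<^sup>2 = (Q k)\<^sup>2 * (4 / 9) ^ m"
      by (simp add: power2_eq_square mult_ac flip: power_mult_distrib)
    moreover have "3 * real k - real n = real m"
      using m by linarith
    ultimately have "(3 * real k - real n) * (b k)\<^sup>2 = (real m * (4 / 9) ^ m) * (Q k)\<^sup>2"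
      by simp
    also have "\<dots> \<le> 1 * (Q k)\<^sup>2"
    proof (intro mult_right_mono)
      have "real m * (4 / 9) ^ m \<le> 2 ^ m * (1 / 2) ^ m"
        by (intro mult_mono power_mono) (auto intro: less_imp_le)
      also have "\<dots> = 1"
        by (simp flip: power_mult_distrib)
      finally show "real m * (4 / 9) ^ m \<le> 1" .
    qed simp
    also have "\<dots> \<le> Q k"
      using Q0[of k] Q1[OF that] by (simp add: power2_eq_square mult_left_le)
    finally show ?thesis .
  qed
  have "(\<Sum>k\<le>n. (3 * real k - real n) * (b k)\<^sup>2)
      = - real n + (\<Sum>k\<in>{..n} - {0}. (3 * real k - real n) * (b k)\<^sup>2)"
    by (subst sum.remove[of _ 0]) (auto simp: \<open>b 0 = 1\<close>)
  also have "\<dots> \<le> - real n + (\<Sum>k\<in>{..n} - {0}. Q k)"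
    using term_le by (intro add_left_mono sum_mono) auto
  also have "\<dots> \<le> - real n + (\<Sum>k\<le>n. Q k)"
    using Q0 by (intro add_left_mono sum_mono2) auto
  also have "\<dots> \<le> 0"
    using sumQ \<open>n \<ge> 1\<close> by linarith
  finally have le0: "(\<Sum>k\<le>n. (3 * real k - real n) * (b k)\<^sup>2) \<le> 0" .
  have "2 * (\<Sum>k\<le>n. real k * (b k)\<^sup>2) - (\<Sum>k\<le>n. real (n - k) * (b k)\<^sup>2)
      = (\<Sum>k\<le>n. 2 * (real k * (b k)\<^sup>2) - real (n - k) * (b k)\<^sup>2)"
    by (simp only: sum_distrib_left sum_subtractf)
  also have "\<dots> = (\<Sum>k\<le>n. (3 * real k - real n) * (b k)\<^sup>2)"
    by (intro sum.cong) (auto simp: of_nat_diff algebra_simps)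
  finally show ?thesis using le0 by simp
qed

text \<open>
  The scaling \<open>y\<^sub>i = (27/4) \<bar>\<beta>\<^sub>i\<bar>\<close> turns the bound on \<open>\<lambda>\<close> into \<open>\<Sum> y\<^sub>i\<^sup>n \<le> n\<close>, and
  \<open>(27/8) \<bar>\<beta>\<^sub>i\<bar> = y\<^sub>i / 2\<close>.
\<close>

theorem theorem2p2:
  fixes n :: nat and \<alpha> :: "nat \<Rightarrow> complex" and lam :: real and F :: "complex poly"
  assumes "n \<ge> 1"
    and "lam > 0"
    and "F = (\<Prod>i=1..n. [:- (\<alpha> i / complex_of_real lam), 1:])"
    and "lam \<ge> 6.75 * root n ((1 / real n) * (\<Sum>i=1..n. cmod (\<alpha> i) ^ n))"
  shows "(dirichlet_norm (blaschke_cofactor F))\<^sup>2 \<le> (1 / 2) * (dirichlet_norm F)\<^sup>2"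
proof -
  define \<beta> where "\<beta> i = \<alpha> i / complex_of_real lam" for i
  define y where "y i = 27 / 4 * cmod (\<beta> i)" for i
  define S where "S = (\<Sum>i=1..n. cmod (\<alpha> i) ^ n)"
  define G where "G = (\<Prod>i=1..n. [:1, - cnj (\<beta> i):])"
  have F: "F = (\<Prod>i=1..n. [:- \<beta> i, 1:])"
    using assms(3) by (simp add: \<beta>_def)
  have y0: "y i \<ge> 0" for i by (simp add: y_def)

  have "S \<ge> 0" by (simp add: S_def sum_nonneg)
  have "root n (S / real n) \<le> 4 / 27 * lam"
    using assms(4) by (simp add: S_def)
  then have "root n (S / real n) ^ n \<le> (4 / 27 * lam) ^ n"
    using \<open>S \<ge> 0\<close> assms(1) by (intro power_mono real_root_ge_zero) auto
  then have "S / real n \<le> (4 / 27 * lam) ^ n"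
    using \<open>S \<ge> 0\<close> assms(1) by (simp add: real_root_pow_pos2)
  then have S_le: "S \<le> real n * (4 / 27 * lam) ^ n"
    using assms(1) by (simp add: field_simps)
  have "(\<Sum>i=1..n. y i ^ n) = (\<Sum>i=1..n. cmod (\<alpha> i) ^ n / (4 / 27 * lam) ^ n)"
    using assms(2)
    by (intro sum.cong refl, subst power_divide[symmetric])
      (simp add: y_def \<beta>_def norm_divide mult.commute)
  also have "\<dots> = S / (4 / 27 * lam) ^ n"
    by (simp only: S_def sum_divide_distrib)
  also have "\<dots> \<le> real n"
    using S_le assms(2) by (simp add: divide_le_eq)
  finally have sum_y: "(\<Sum>i=1..n. y i ^ n) \<le> real n" .

  have disk: "cmod (\<beta> i) < 1" if "i \<in> {1..n}" for i
  proof (rule ccontr)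
    assume "\<not> cmod (\<beta> i) < 1"
    then have "y i \<ge> 2" by (simp add: y_def)
    then have "2 ^ n \<le> y i ^ n" by (intro power_mono) auto
    also have "\<dots> \<le> (\<Sum>i=1..n. y i ^ n)"
      using that y0 by (intro member_le_sum) auto
    also note sum_y
    finally show False using of_nat_less_two_power[of n, where ?'a = real] by linarith
  qed
  have cofactor: "blaschke_cofactor F = G"
    unfolding F G_def using disk by (intro blaschke_cofactor_roots_in_disk) auto

  define b where "b k = cmod (coeff G k)" for k
  have degF: "degree F = n"
    by (simp add: F degree_prod_linear_factors)
  have G_reflect: "G = map_poly cnj (reflect_poly F)"
    unfolding F G_def by (rule prod_linear_factors_eq_map_cnj_reflect)
  have b_eq: "b k = cmod (coeff F (n - k))" if "k \<le> n" for k
    using that by (simp add: b_def G_reflect coeff_map_poly coeff_reflect_poly degF)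
  have "degree G \<le> n"
    by (rule degree_le) (simp add: G_reflect coeff_map_poly coeff_reflect_poly degF)
  then have normG: "(dirichlet_norm G)\<^sup>2 = (\<Sum>k\<le>n. real k * (b k)\<^sup>2)"
    unfolding b_def by (rule dirichlet_norm_squared_atMost)
  have "(dirichlet_norm F)\<^sup>2 = (\<Sum>k\<le>n. real k * (cmod (coeff F k))\<^sup>2)"
    by (rule dirichlet_norm_squared_atMost) (simp add: degF)
  also have "\<dots> = (\<Sum>k\<le>n. real (n - k) * (b k)\<^sup>2)"
    by (rule sum.reindex_bij_witness[of _ "\<lambda>k. n - k" "\<lambda>k. n - k"]) (auto simp: b_eq)
  finally have normF: "(dirichlet_norm F)\<^sup>2 = (\<Sum>k\<le>n. real (n - k) * (b k)\<^sup>2)" .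

  have "(\<Sum>k\<le>n. b k * (27 / 8) ^ k) \<le> (\<Prod>i=1..n. 1 + 27 / 8 * cmod (- cnj (\<beta> i)))"
    using weighted_coeff_sum_linear_factors_le[of "{1..n}" "27 / 8" "\<lambda>i. - cnj (\<beta> i)"]
    by (simp add: b_def G_def)
  also have "\<dots> = (\<Prod>i=1..n. 1 + y i / 2)"
    by (simp add: y_def)
  also have "\<dots> \<le> (3 / 2) ^ n"
    using y0 sum_y assms(1) by (intro prod_one_plus_half_le) auto
  finally have decay: "(\<Sum>k\<le>n. b k * (27 / 8) ^ k) \<le> (3 / 2) ^ n" .
  have "b 0 = 1"
    by (simp add: b_def G_def poly_prod flip: poly_0_coeff_0)
  then show ?thesis
    unfolding cofactor normG normF
    using assms(1) decay by (intro sum_weighted_squares_le_half) (auto simp: b_def)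
qed

end
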